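(* Any Goodstein walk for $\mathcal M$, $\mathcal E$, or $\mathcal L$ is finite.
   Context: Three notation systems are considered; for each base $k\ge2$ their base $k$ terms are the closed terms built from the following operations (where $k\cdot x$ in $\mathcal M$ and $k^x$ are unary operations with the fixed base $k$): $\mathcal M$: $0$, $1$, $x+y$, $k\cdot x$; $\mathcal E$: $0$, $x+y$, $k^x$; $\mathcal L$: $0$, $x+y$, $x\cdot y$, $k^x$. The value $|\tau|\in\mathbb N$ of a term is the natural number obtained by evaluating it. For $k\le\ell$ and a base $k$ term $\tau$, $\uparrow^\ell\tau$ is the base $\ell$ term obtained by replacing every occurrence of the base $k$ by $\ell$ (i.e. operations $k\cdot x$ become $\ell\cdot x$ and $k^x$ become $\ell^x$, hereditarily). A Goodstein walk for a notation system $\mathcal F$ is a sequence $(m_i)_{i<\alpha}$ of natural numbers, where $\alpha\leq\infty$, such that for every $i<\alpha$ there is a base $(i+2)$ term $\tau_i$ of $\mathcal F$ with $|\tau_i|=m_i$ and, if $i+1<\alpha$, $m_{i+1}=|\uparrow^{i+3}\tau_i|-1$ (ordinary subtraction, so that $|\uparrow^{i+3}\tau_i|\geq1$ in this case). The walk is finite if $\alpha<\infty$. *)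

theory Defs
  imports Main "HOL-Library.Extended_Nat"
begin

text \<open>
  One datatype holds the operations of all three notation systems; the base of the unary
  operations \<open>k \<cdot> x\<close> and \<open>k\<^sup>x\<close> is part of the syntax, so that the base change is a
  syntactic operation on terms.
\<close>

datatype tm =
    Zero
  | One
  | Add tm tm
  | Mul tm tm
  | Scale nat tm  \<comment> \<open>\<open>Scale k x\<close> is \<open>k \<cdot> x\<close>\<close>
  | Pow nat tm    \<comment> \<open>\<open>Pow k x\<close> is \<open>k\<^sup>x\<close>\<close>

datatype notation_system = SysM | SysE | SysL

inductive_set base_terms :: "notation_system \<Rightarrow> nat \<Rightarrow> tm set"
  for F :: notation_system and k :: nat
where
  Zero: "Zero \<in> base_terms F k"
| One: "F = SysM \<Longrightarrow> One \<in> base_terms F k"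
| Add: "s \<in> base_terms F k \<Longrightarrow> t \<in> base_terms F k \<Longrightarrow> Add s t \<in> base_terms F k"
| Mul: "F = SysL \<Longrightarrow> s \<in> base_terms F k \<Longrightarrow> t \<in> base_terms F k \<Longrightarrow> Mul s t \<in> base_terms F k"
| Scale: "F = SysM \<Longrightarrow> t \<in> base_terms F k \<Longrightarrow> Scale k t \<in> base_terms F k"
| Pow: "F = SysE \<or> F = SysL \<Longrightarrow> t \<in> base_terms F k \<Longrightarrow> Pow k t \<in> base_terms F k"

primrec val :: "tm \<Rightarrow> nat" where
  "val Zero = 0"
| "val One = 1"
| "val (Add s t) = val s + val t"
| "val (Mul s t) = val s * val t"
| "val (Scale k t) = k * val t"
| "val (Pow k t) = k ^ val t"

text \<open>
  On a base \<open>k\<close> term every base occurring is \<open>k\<close>, so the old base need not be an argument.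
\<close>

primrec upgrade :: "nat \<Rightarrow> tm \<Rightarrow> tm" where
  "upgrade l Zero = Zero"
| "upgrade l One = One"
| "upgrade l (Add s t) = Add (upgrade l s) (upgrade l t)"
| "upgrade l (Mul s t) = Mul (upgrade l s) (upgrade l t)"
| "upgrade l (Scale k t) = Scale l (upgrade l t)"
| "upgrade l (Pow k t) = Pow l (upgrade l t)"

text \<open>
  The walk is \<open>(m i)\<close> for \<open>i < \<alpha>\<close>; the values of \<open>m\<close> at indices \<open>i \<ge> \<alpha>\<close> are irrelevant.
  The subtraction is taken in the integers, so it is not truncated: a step from \<open>m i\<close> is
  only possible if the upgraded term has positive value.
\<close>

definition goodstein_walk :: "notation_system \<Rightarrow> enat \<Rightarrow> (nat \<Rightarrow> nat) \<Rightarrow> bool" where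
  "goodstein_walk F \<alpha> m \<longleftrightarrow>
    (\<forall>i. enat i < \<alpha> \<longrightarrow>
      (\<exists>\<tau> \<in> base_terms F (i + 2).
        val \<tau> = m i \<and>
        (enat (i + 1) < \<alpha> \<longrightarrow> int (m (i + 1)) = int (val (upgrade (i + 3) \<tau>)) - 1)))"

end

theory Submission
  imports Defs
begin

text \<open>
  Let \<open>bump k l n\<close> be the value obtained by writing \<open>n\<close> in hereditary base \<open>k\<close> normal form and
  replacing \<open>k\<close> by \<open>l\<close>. Two facts about this function make every walk finite.

  No term grows more under a base change than the normal form of its value. The
  function \<open>bump k l\<close> is superadditive, supermultiplicative, and sends \<open>k\<close> to \<open>l\<close> and \<open>k ^ a\<close>
  to \<open>l ^ bump k l a\<close>; by induction on terms, an arbitrary term \<open>t\<close> of any of the three systems satisfies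
  \<open>val (upgrade l t) \<le> bump k l (val t)\<close> (\<open>val_upgrade_le_bump\<close>). A walk therefore steps from
  \<open>m\<close> at base \<open>k\<close> to some number \<^emph>\<open>strictly below\<close> \<open>bump k (k + 1) m\<close>.

  Such steps cannot go on forever. Replacing the base by \<open>\<omega>\<close> turns \<open>n\<close> at base \<open>k\<close> into an
  ordinal below \<open>\<epsilon>\<^sub>0\<close>; \<open>bump\<close> preserves this ordinal and a step decreases it. The proof does not
  construct the ordinals: it shows directly that the relation ``\<open>n'\<close> at base \<open>l\<close> lies below the
  bump of \<open>n\<close> at base \<open>k < l\<close>'' is well-founded. The core is \<open>extensible_if_acc\<close>, the
  counterpart of the step from \<open>\<gamma>\<close> to \<open>\<gamma> + \<omega> ^ \<alpha>\<close> in the usual proof that \<open>\<epsilon>\<^sub>0\<close> is well-ordered: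
  if the exponent \<open>a\<close> is accessible, then adding \<open>c * k ^ a\<close> with \<open>c < k\<close> below the lowest nonzero
  digit of an accessible number keeps it accessible. Since a positive number is built in this way from
  exponents smaller than itself, all numbers are accessible.
\<close>

section \<open>Weighted sums of digits\<close>

text \<open>
  The digits of \<open>n\<close> in base \<open>k\<close>, with the power \<open>k ^ i\<close> replaced by an arbitrary weight \<open>e i\<close>.
  Ranging over \<open>i < n\<close> loses nothing, because all digits from position \<open>n\<close> on vanish; this
  range is what allows weights that depend recursively on the position in \<open>bump\<close>.
\<close>

definition digit_sum :: "nat \<Rightarrow> (nat \<Rightarrow> nat) \<Rightarrow> nat \<Rightarrow> nat" where
  "digit_sum k e n = (\<Sum>i<n. (n div k ^ i mod k) * e i)"

lemma digit_eq_0: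
  fixes k n i :: nat
  assumes "2 \<le> k" and "n \<le> i"
  shows "n div k ^ i = 0"
  using power_gt_expt[of k i] assms by (simp add: div_less)

lemma digit_sum_upto:
  assumes "2 \<le> k" and "n \<le> N"
  shows "digit_sum k e n = (\<Sum>i<N. (n div k ^ i mod k) * e i)"
  unfolding digit_sum_def
  by (rule sum.mono_neutral_left) (use assms in \<open>auto simp: digit_eq_0\<close>)

lemma digit_sum_0 [simp]: "digit_sum k e 0 = 0"
  by (simp add: digit_sum_def)

lemma digit_sum_rec:
  assumes k: "2 \<le> k"
  shows "digit_sum k e n = (n mod k) * e 0 + digit_sum k (\<lambda>i. e (Suc i)) (n div k)"
proof -
  have "digit_sum k e n = (\<Sum>i<Suc n. (n div k ^ i mod k) * e i)"
    using k by (intro digit_sum_upto) auto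
  also have "\<dots> = (n mod k) * e 0 + (\<Sum>i<n. (n div k div k ^ i mod k) * e (Suc i))"
    by (subst sum.lessThan_Suc_shift) (simp add: div_mult2_eq)
  also have "(\<Sum>i<n. (n div k div k ^ i mod k) * e (Suc i)) = digit_sum k (\<lambda>i. e (Suc i)) (n div k)"
    using k by (intro digit_sum_upto[symmetric]) auto
  finally show ?thesis .
qed

lemma digit_sum_power:
  assumes k: "2 \<le> k" and c: "c < k"
  shows "digit_sum k e (c * k ^ a) = c * e a"
proof (induction a arbitrary: e)
  case 0
  then show ?case using k c by (subst digit_sum_rec) auto
next
  case (Suc a)
  then show ?case using k c
    by (subst digit_sum_rec) (auto simp: mult.left_commute)
qed

lemma digit_sum_powers:
  assumes k: "2 \<le> k"
  shows "digit_sum k (\<lambda>i. b * k ^ i) n = b * n"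
proof (induction n arbitrary: b rule: less_induct)
  case (less n)
  show ?case
  proof (cases "n = 0")
    case False
    then have "n div k < n" using k by simp
    from less[OF this, of "b * k"] k
    have "digit_sum k (\<lambda>i. b * k ^ i) n = b * (n mod k) + b * (k * (n div k))"
      by (subst digit_sum_rec) (auto simp: mult.assoc)
    then show ?thesis by (metis distrib_left mod_mult_div_eq)
  qed simp
qed

text \<open>
  The numbers \<open>x\<close> and \<open>y\<close> occupy disjoint sets of digit positions, so nothing is carried.
\<close>

lemma digit_sum_add_disjoint:
  assumes k: "2 \<le> k"
  shows "k ^ a dvd x \<Longrightarrow> y < k ^ a \<Longrightarrow> digit_sum k e (x + y) = digit_sum k e x + digit_sum k e y"
proof (induction a arbitrary: x y e)
  case (Suc a)
  from Suc.prems obtain z where z: "x = k ^ Suc a * z" by blast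
  define x' where "x' = k ^ a * z"
  have x: "x = k * x'" using z by (simp add: x'_def)
  have y: "y div k < k ^ a"
    using Suc.prems(2) k by (simp add: less_mult_imp_div_less mult.commute)
  have "(x + y) div k = x' + y div k" "(x + y) mod k = y mod k"
    using x k by auto
  moreover have "x mod k = 0" "x div k = x'" using x k by auto
  ultimately show ?case
    using Suc.IH[of x' "y div k" "\<lambda>i. e (Suc i)"] y
      digit_sum_rec[OF k, of e "x + y"] digit_sum_rec[OF k, of e x] digit_sum_rec[OF k, of e y]
    by (simp add: x'_def)
qed simp

text \<open>
  Adding two numbers digit by digit, a carry trades \<open>k\<close> units of weight \<open>e i\<close> for one unit of
  weight \<open>e (Suc i)\<close>, which is at least as much. The growth condition is restricted to positions
  below \<open>m + n\<close>: for the weights of \<open>bump\<close> it comes from the induction hypothesis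
  of \<open>bump_superadditive\<close>, which speaks only of smaller numbers.
\<close>

lemma digit_sum_superadditive:
  assumes k: "2 \<le> k"
  shows "(\<And>i. Suc i < m + n \<Longrightarrow> k * e i \<le> e (Suc i)) \<Longrightarrow>
    digit_sum k e m + digit_sum k e n \<le> digit_sum k e (m + n)"
proof (induction "m + n" arbitrary: m n e rule: less_induct)
  case less
  show ?case
  proof (cases "m = 0 \<or> n = 0")
    case False
    let ?e = "\<lambda>i. e (Suc i)"
    let ?D = "digit_sum k ?e"
    let ?q = "m div k" and ?q' = "n div k" and ?r = "m mod k" and ?r' = "n mod k"
    have pos: "m > 0" "n > 0" using False by auto
    have lt: "(m + n) div k < m + n" using k pos by simp
    have grow: "k * ?e i \<le> ?e (Suc i)" if "Suc i < (m + n) div k" for i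
      using less.prems[of "Suc i"] that lt by simp
    have decomp: "m + n = (?r + ?r') + k * (?q + ?q')"
      by (simp add: algebra_simps)
    have q: "?q + ?q' \<le> (m + n) div k"
      by (simp add: div_add1_eq[of m n k])
    have IH: "?D ?q + ?D ?q' \<le> ?D (?q + ?q')"
      by (rule less.hyps) (use q lt grow in auto)
    have rec: "digit_sum k e m = ?r * e 0 + ?D ?q" "digit_sum k e n = ?r' * e 0 + ?D ?q'"
      "digit_sum k e (m + n) = ((m + n) mod k) * e 0 + ?D ((m + n) div k)"
      using k by (rule digit_sum_rec)+
    show ?thesis
    proof (cases "?r + ?r' < k")
      case True
      then have "(m + n) mod k = ?r + ?r'" "(m + n) div k = ?q + ?q'"
        using mod_add_eq[of m k n] by (auto simp: div_add1_eq[of m n k])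
      then show ?thesis using IH rec by (simp add: algebra_simps)
    next
      case False
      define s where "s = ?r + ?r' - k"
      have "?r < k" "?r' < k" using k by auto
      then have s: "?r + ?r' = s + k" "s < k" using False unfolding s_def by linarith+
      have "m + n = s + k * (?q + ?q' + 1)" using decomp s by simp
      moreover have "(s + k * q) mod k = s" "(s + k * q) div k = q" for q
        using s(2) by auto
      ultimately have md: "(m + n) mod k = s" and dv: "(m + n) div k = ?q + ?q' + 1"
        by metis+
      \<comment> \<open>The carry is itself added as a number: its contribution is \<open>e 1\<close>, which pays for \<open>k\<close>
        units of weight \<open>e 0\<close>.\<close>
      have "?D (?q + ?q') + ?D 1 \<le> ?D (?q + ?q' + 1)"
        by (rule less.hyps) (use dv lt grow in auto)
      moreover have "?D 1 = e 1"
        using digit_sum_power[OF k, of 1 ?e 0] k by simp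
      moreover have "k * e 0 \<le> e 1" using less.prems[of 0] pos by simp
      moreover have "?r * e 0 + ?r' * e 0 = s * e 0 + k * e 0"
        using s(1) by (metis add_mult_distrib)
      ultimately show ?thesis using rec md dv IH by simp
    qed
  qed auto
qed

section \<open>Base change in hereditary normal form\<close>

function bump :: "nat \<Rightarrow> nat \<Rightarrow> nat \<Rightarrow> nat" where
  "bump k l n = (\<Sum>i<n. (n div k ^ i mod k) * l ^ bump k l i)"
  by auto
termination by (relation "measure (\<lambda>(k, l, n). n)") auto

declare bump.simps [simp del]

lemma bump_digit_sum: "bump k l n = digit_sum k (\<lambda>i. l ^ bump k l i) n"
  by (subst bump.simps) (simp add: digit_sum_def)

lemma bump_0 [simp]: "bump k l 0 = 0"
  by (subst bump_digit_sum) simp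

lemma bump_mult_power:
  assumes "2 \<le> k" and "c < k"
  shows "bump k l (c * k ^ a) = c * l ^ bump k l a"
  using assms by (subst bump_digit_sum) (rule digit_sum_power)

lemma bump_power:
  assumes "2 \<le> k"
  shows "bump k l (k ^ a) = l ^ bump k l a"
  using bump_mult_power[of k 1 l a] assms by simp

lemma bump_1:
  assumes "2 \<le> k"
  shows "bump k l 1 = 1"
  using bump_power[OF assms, of l 0] by simp

lemma bump_base:
  assumes "2 \<le> k"
  shows "bump k l k = l"
  using bump_power[OF assms, of l 1] bump_1[OF assms] by simp

lemma bump_add_disjoint:
  assumes "2 \<le> k" and "k ^ a dvd x" and "y < k ^ a"
  shows "bump k l (x + y) = bump k l x + bump k l y"
  using digit_sum_add_disjoint[OF assms]
  by (simp only: bump_digit_sum[of k l "x + y"] bump_digit_sum[of k l x] bump_digit_sum[of k l y])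

text \<open>
  Superadditivity for smaller numbers gives \<open>bump k l i + 1 \<le> bump k l (Suc i)\<close>, hence
  consecutive weights \<open>l ^ bump k l i\<close> grow by a factor of at least \<open>l\<close>, and \<open>l \<ge> k\<close>.
\<close>

lemma bump_superadditive:
  assumes k: "2 \<le> k" and kl: "k \<le> l"
  shows "bump k l m + bump k l n \<le> bump k l (m + n)"
proof (induction "m + n" arbitrary: m n rule: less_induct)
  case less
  have "k * l ^ bump k l i \<le> l ^ bump k l (Suc i)" if "Suc i < m + n" for i
  proof -
    have "bump k l i + 1 \<le> bump k l (Suc i)"
      using less[of i 1] that bump_1[OF k] by simp
    then have "l ^ (bump k l i + 1) \<le> l ^ bump k l (Suc i)"
      using k kl by (intro power_increasing) auto
    moreover have "k * l ^ bump k l i \<le> l ^ (bump k l i + 1)"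
      using kl by simp
    ultimately show ?thesis by (rule order_trans[rotated])
  qed
  from digit_sum_superadditive[OF k, of m n "\<lambda>i. l ^ bump k l i", OF this] show ?case
    by (simp only: bump_digit_sum[of k l "m + n"] bump_digit_sum[of k l m] bump_digit_sum[of k l n])
qed

lemma bump_strict_mono:
  assumes k: "2 \<le> k" and kl: "k \<le> l" and "m < n"
  shows "bump k l m < bump k l n"
proof -
  have suc: "bump k l i < bump k l (Suc i)" for i
    using bump_superadditive[OF k kl, of i 1] bump_1[OF k] by simp
  show ?thesis using lift_Suc_mono_less[of "bump k l", OF suc assms(3)] .
qed

lemma bump_mono:
  assumes "2 \<le> k" and "k \<le> l" and "m \<le> n"
  shows "bump k l m \<le> bump k l n"
  using bump_strict_mono[OF assms(1,2), of m n] assms(3) by (cases "m = n") auto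

lemma bump_linear_combination:
  assumes k: "2 \<le> k" and kl: "k \<le> l"
  shows "(\<Sum>i<(N::nat). c i * bump k l (f i)) \<le> bump k l (\<Sum>i<N. c i * f i)"
proof -
  have mult: "c * bump k l x \<le> bump k l (c * x)" for c x
  proof (induction c)
    case (Suc c)
    then show ?case using bump_superadditive[OF k kl, of x "c * x"] by simp
  qed simp
  show ?thesis
  proof (induction N)
    case (Suc N)
    then show ?case
      using mult[of "c N" "f N"]
        bump_superadditive[OF k kl, of "\<Sum>i<N. c i * f i" "c N * f N"] by simp
  qed simp
qed

text \<open>
  For powers of \<open>k\<close> the inequality is superadditivity in the exponent. The general case expands
  both factors into digits and collects the products by superadditivity.
\<close>

lemma bump_supermultiplicative:
  assumes k: "2 \<le> k" and kl: "k \<le> l"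
  shows "bump k l m * bump k l n \<le> bump k l (m * n)"
proof -
  let ?d = "\<lambda>n i. n div k ^ i mod k"
  let ?B = "bump k l"
  have expand: "(\<Sum>i<n. ?d n i * (b * k ^ i)) = b * n" for b n
    using digit_sum_powers[OF k, of b n] by (simp add: digit_sum_def)
  have power: "l ^ ?B a * ?B n \<le> ?B (k ^ a * n)" for a n
  proof -
    have "l ^ ?B a * ?B n = (\<Sum>i<n. ?d n i * l ^ (?B a + ?B i))"
      by (subst (2) bump.simps) (simp add: sum_distrib_left power_add algebra_simps)
    also have "\<dots> \<le> (\<Sum>i<n. ?d n i * ?B (k ^ a * k ^ i))"
    proof (intro sum_mono mult_left_mono)
      fix i
      have "l ^ (?B a + ?B i) \<le> l ^ ?B (a + i)"
        using bump_superadditive[OF k kl] k kl by (intro power_increasing) auto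
      then show "l ^ (?B a + ?B i) \<le> ?B (k ^ a * k ^ i)"
        by (simp add: bump_power[OF k] flip: power_add)
    qed simp
    also have "\<dots> \<le> ?B (\<Sum>i<n. ?d n i * (k ^ a * k ^ i))"
      by (rule bump_linear_combination[OF k kl])
    finally show ?thesis by (simp add: expand)
  qed
  have "?B m * ?B n = (\<Sum>i<m. ?d m i * (l ^ ?B i * ?B n))"
    by (subst bump.simps) (simp add: sum_distrib_right mult.assoc)
  also have "\<dots> \<le> (\<Sum>i<m. ?d m i * ?B (k ^ i * n))"
    using power by (intro sum_mono mult_left_mono) auto
  also have "\<dots> \<le> ?B (\<Sum>i<m. ?d m i * (k ^ i * n))"
    by (rule bump_linear_combination[OF k kl])
  finally show ?thesis using expand[of m n] by (simp add: mult.commute)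
qed

text \<open>
  The laws of \<open>bump\<close> match the operations one by one; \<open>Scale k\<close> counts as multiplication by \<open>k\<close>,
  which \<open>bump\<close> sends to \<open>l\<close>.
\<close>

lemma val_upgrade_le_bump:
  assumes k: "2 \<le> k" and kl: "k \<le> l" and "t \<in> base_terms F k"
  shows "val (upgrade l t) \<le> bump k l (val t)"
  using assms(3)
proof induction
  case (Add s t)
  then show ?case using bump_superadditive[OF k kl, of "val s" "val t"] by simp
next
  case (Mul s t)
  then have "val (upgrade l s) * val (upgrade l t) \<le> bump k l (val s) * bump k l (val t)"
    by (intro mult_mono) auto
  then show ?case using bump_supermultiplicative[OF k kl, of "val s" "val t"] by simp
next
  case (Scale t)
  then have "l * val (upgrade l t) \<le> l * bump k l (val t)" by simp
  also have "\<dots> \<le> bump k l (k * val t)"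
    using bump_supermultiplicative[OF k kl, of k "val t"] by (simp only: bump_base[OF k])
  finally show ?case by simp
next
  case (Pow t)
  then have "l ^ val (upgrade l t) \<le> l ^ bump k l (val t)"
    using k kl by (intro power_increasing) auto
  then show ?case by (simp add: bump_power[OF k])
qed (auto simp: bump_1[OF k, simplified])

text \<open>
  Divisibility by \<open>k ^ a\<close> says that the digits below position \<open>a\<close> vanish, and \<open>bump\<close> moves the
  others to positions not below \<open>bump k l a\<close>.
\<close>

lemma power_dvd_bump:
  assumes k: "2 \<le> k" and kl: "k \<le> l" and dvd: "k ^ a dvd n"
  shows "l ^ bump k l a dvd bump k l n"
proof (subst (2) bump.simps, rule dvd_sum)
  fix i
  show "l ^ bump k l a dvd n div k ^ i mod k * l ^ bump k l i"
  proof (cases "a \<le> i")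
    case True
    then show ?thesis using bump_mono[OF k kl] by (intro dvd_mult le_imp_power_dvd)
  next
    case False
    then have "k ^ Suc i dvd n" using dvd by (meson Suc_leI dvd_trans le_imp_power_dvd not_le)
    then obtain z where "n = k ^ Suc i * z" by blast
    then have "n div k ^ i = k * z" using k by simp
    then show ?thesis by simp
  qed
qed

text \<open>
  The sum defining \<open>bump k j n\<close> is already in base \<open>j\<close> normal form: its coefficients are less than
  \<open>k \<le> j\<close> and its exponents \<open>bump k j i\<close> are strictly increasing. So \<open>bump j l\<close> acts on each
  summand separately, and on the exponents by induction.
\<close>

lemma bump_bump:
  assumes k: "2 \<le> k" and kj: "k \<le> j" and jl: "j \<le> l"
  shows "bump j l (bump k j n) = bump k l n"
proof (induction n rule: less_induct)
  case (less n)
  let ?d = "\<lambda>i. n div k ^ i mod k"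
  let ?B = "bump k j"
  have j: "2 \<le> j" using k kj by simp
  have bound: "(\<Sum>i<N. ?d i * j ^ ?B i) < j ^ ?B N" for N
  proof (induction N)
    case (Suc N)
    have "Suc (?d N) \<le> j" using k kj mod_less_divisor[of k "n div k ^ N"] by linarith
    then have "Suc (?d N) * j ^ ?B N \<le> j * j ^ ?B N" by (rule mult_right_mono) simp
    also have "\<dots> = j ^ Suc (?B N)" by simp
    also have "\<dots> \<le> j ^ ?B (Suc N)"
      using bump_strict_mono[OF k kj, of N "Suc N"] j by (intro power_increasing) auto
    finally show ?case using Suc by simp
  qed simp
  have "bump j l (\<Sum>i<N. ?d i * j ^ ?B i) = (\<Sum>i<N. ?d i * l ^ bump k l i)" if "N \<le> n" for N
    using that
  proof (induction N)
    case (Suc N)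
    have "?d N < j" using k kj mod_less_divisor[of k "n div k ^ N"] by linarith
    then have "bump j l (?d N * j ^ ?B N) = ?d N * l ^ bump j l (?B N)"
      by (rule bump_mult_power[OF j])
    also have "bump j l (?B N) = bump k l N" using less[of N] Suc.prems by simp
    finally show ?case
      using bump_add_disjoint[OF j, of "?B N" "?d N * j ^ ?B N" "\<Sum>i<N. ?d i * j ^ ?B i" l]
        bound[of N] Suc by (simp add: add.commute)
  qed simp
  then show ?case by (simp add: bump.simps[of k j n] bump.simps[of k l n])
qed

section \<open>Well-foundedness of the descent\<close>

text \<open>
  The new base \<open>l\<close> need not be \<open>k + 1\<close>. Allowing every larger base makes accessibility
  invariant under \<open>bump\<close> (\<open>acc_descent_bump\<close>), as befits a property of the ordinal that \<open>n\<close>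
  at base \<open>k\<close> denotes.
\<close>

definition descent :: "((nat \<times> nat) \<times> (nat \<times> nat)) set" where
  "descent = {((l, n'), (k, n)) | k l n n'. 2 \<le> k \<and> k < l \<and> n' < bump k l n}"

lemma acc_descentI:
  assumes "\<And>l n'. 2 \<le> k \<Longrightarrow> k < l \<Longrightarrow> n' < bump k l n \<Longrightarrow> (l, n') \<in> Wellfounded.acc descent"
  shows "(k, n) \<in> Wellfounded.acc descent"
  by (rule Wellfounded.accI) (use assms in \<open>auto simp: descent_def\<close>)

lemma acc_descentD:
  assumes "(k, n) \<in> Wellfounded.acc descent" and "2 \<le> k" and "k < l" and "n' < bump k l n"
  shows "(l, n') \<in> Wellfounded.acc descent"
  using assms by (auto intro: Wellfounded.acc_downward simp: descent_def)

lemma acc_descent_bump: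
  assumes acc: "(k, n) \<in> Wellfounded.acc descent" and k: "2 \<le> k" and kl: "k < l"
  shows "(l, bump k l n) \<in> Wellfounded.acc descent"
proof (rule acc_descentI)
  fix j n' assume "l < j" "n' < bump l j (bump k l n)"
  then show "(j, n') \<in> Wellfounded.acc descent"
    using acc_descentD[OF acc k, of j n'] kl by (simp add: bump_bump[OF k])
qed

text \<open>
  Accessible numbers whose digits at positions up to \<open>a\<close> all vanish stay accessible under any
  choice of the digit at position \<open>a\<close>. Since these digits vanish, changing the one at \<open>a\<close> causes
  no carry, and \<open>bump\<close> is additive for it.
\<close>

definition extensible :: "nat \<Rightarrow> nat \<Rightarrow> bool" where
  "extensible k a \<longleftrightarrow> (\<forall>n c. k ^ Suc a dvd n \<longrightarrow> c < k \<longrightarrow>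
    (k, n) \<in> Wellfounded.acc descent \<longrightarrow> (k, n + c * k ^ a) \<in> Wellfounded.acc descent)"

text \<open>
  The digits of \<open>r\<close> are added one at a time, from position \<open>a - 1\<close> downwards.
\<close>

lemma acc_descent_add:
  assumes k: "2 \<le> k"
  shows "(\<And>b. b < a \<Longrightarrow> extensible k b) \<Longrightarrow> k ^ a dvd n \<Longrightarrow> r < k ^ a \<Longrightarrow>
    (k, n) \<in> Wellfounded.acc descent \<Longrightarrow> (k, n + r) \<in> Wellfounded.acc descent"
proof (induction a arbitrary: n r)
  case (Suc a)
  define c where "c = r div k ^ a"
  have c: "c < k" using Suc.prems(3) by (simp add: c_def less_mult_imp_div_less)
  have "(k, n + c * k ^ a) \<in> Wellfounded.acc descent"
    using Suc.prems c by (auto simp: extensible_def)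
  moreover have "k ^ a dvd n + c * k ^ a" 
    using Suc.prems(2) by (auto intro: dvd_add dvd_trans[of _ "k ^ Suc a"])
  ultimately have "(k, n + c * k ^ a + r mod k ^ a) \<in> Wellfounded.acc descent"
    using Suc.IH Suc.prems(1) k by simp
  then show ?case by (simp only: c_def add.assoc div_mult_mod_eq)
qed simp

text \<open>
  By accessibility induction on the exponent \<open>a\<close>, and then on the digit: a descent from
  \<open>n + (c + 1) * k ^ a\<close> to base \<open>l\<close> either is a descent from \<open>n + c * k ^ a\<close>, or leads to the bump
  of \<open>n + c * k ^ a\<close> plus some \<open>r < l ^ bump k l a\<close>. The bump is accessible, and all exponents
  occurring in \<open>r\<close> are descents of \<open>a\<close>, so that they are extensible by induction.
\<close>

lemma extensible_if_acc:
  assumes "(k, a) \<in> Wellfounded.acc descent" and "2 \<le> k"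
  shows "extensible k a"
  using assms
proof (induction "(k, a)" arbitrary: k a rule: Wellfounded.acc.induct)
  case (accI k a)
  have k: "2 \<le> k" by fact
  have IH: "extensible l b" if "k < l" "b < bump k l a" for l b
    using accI.hyps(2)[of l b] that k by (auto simp: descent_def)
  have "(k, n + c * k ^ a) \<in> Wellfounded.acc descent"
    if n: "k ^ Suc a dvd n" and acc: "(k, n) \<in> Wellfounded.acc descent" and "c < k" for n c
    using \<open>c < k\<close>
  proof (induction c)
    case 0
    then show ?case using acc by simp
  next
    case (Suc c)
    then have prev: "(k, n + c * k ^ a) \<in> Wellfounded.acc descent" by simp
    show ?case
    proof (rule acc_descentI)
      fix l n' assume kl: "k < l" and n': "n' < bump k l (n + Suc c * k ^ a)"
      let ?A = "bump k l a"
      have bump: "bump k l (n + d * k ^ a) = bump k l n + d * l ^ ?A" if "d < k" for d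
      proof -
        have "d * k ^ a < k ^ Suc a" using that k by simp
        then show ?thesis
          using bump_add_disjoint[OF k n, of "d * k ^ a" l] bump_mult_power[OF k that] by simp
      qed
      let ?n = "bump k l (n + c * k ^ a)"
      show "(l, n') \<in> Wellfounded.acc descent"
      proof (cases "n' < ?n")
        case True
        then show ?thesis using acc_descentD[OF prev k kl] by simp
      next
        case False
        then obtain r where r: "n' = ?n + r" by (metis le_Suc_ex not_less)
        have "r < l ^ ?A"
          using n' r bump[of c] bump[of "Suc c"] Suc.prems by simp
        moreover have "k ^ a dvd n + c * k ^ a"
          using n by (auto intro: dvd_add dvd_trans[of _ "k ^ Suc a"])
        then have "l ^ ?A dvd ?n" using kl by (intro power_dvd_bump k) auto
        moreover have "(l, ?n) \<in> Wellfounded.acc descent"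
          by (rule acc_descent_bump[OF prev k kl])
        ultimately show ?thesis
          unfolding r using IH[OF kl] k kl by (intro acc_descent_add[of l ?A]) auto
      qed
    qed
  qed
  then show ?case by (simp add: extensible_def)
qed

text \<open>
  As \<open>n < k ^ n\<close>, the digits of \<open>n\<close> are at positions \<open>a < n\<close>, which are accessible by induction, so \<open>n\<close> arises
  from \<open>0\<close> by extensions.
\<close>

lemma acc_descent:
  assumes k: "2 \<le> k"
  shows "(k, n) \<in> Wellfounded.acc descent"
proof (induction n rule: less_induct)
  case (less n)
  have "(k, 0) \<in> Wellfounded.acc descent" by (rule acc_descentI) simp
  moreover have "extensible k b" if "b < n" for b
    using that less k by (intro extensible_if_acc)
  moreover have "n < k ^ n" using k by (intro power_gt_expt) simp
  ultimately have "(k, 0 + n) \<in> Wellfounded.acc descent"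
    by (intro acc_descent_add[OF k, of n]) auto
  then show ?case by simp
qed

lemma wf_descent: "wf descent"
proof (rule acc_wfI, rule allI)
  fix x :: "nat \<times> nat"
  obtain k n where x: "x = (k, n)" by fastforce
  show "x \<in> Wellfounded.acc descent"
  proof (cases "2 \<le> k")
    case False
    then show ?thesis unfolding x by - (rule acc_descentI, simp)
  qed (simp add: x acc_descent)
qed

theorem theorem8p3:
  fixes F :: notation_system and \<alpha> :: enat and m :: "nat \<Rightarrow> nat"
  assumes "goodstein_walk F \<alpha> m"
  shows "\<alpha> < \<infinity>"
proof (rule ccontr)
  assume "\<not> \<alpha> < \<infinity>"
  then have inf: "\<alpha> = \<infinity>" by simp
  have "((Suc i + 2, m (Suc i)), (i + 2, m i)) \<in> descent" for i
  proof -
    have "enat j < \<alpha>" for j using inf by simp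
    then obtain t where t: "t \<in> base_terms F (i + 2)" "val t = m i"
      and step: "int (m (i + 1)) = int (val (upgrade (i + 3) t)) - 1"
      using assms unfolding goodstein_walk_def by blast
    have "val (upgrade (i + 3) t) \<le> bump (i + 2) (i + 3) (m i)"
      using val_upgrade_le_bump[OF _ _ t(1), of "i + 3"] t(2) by simp
    then have "m (Suc i) < bump (i + 2) (i + 3) (m i)" using step by simp
    then have "((i + 3, m (Suc i)), (i + 2, m i)) \<in> descent" by (auto simp: descent_def)
    moreover have "Suc i + 2 = i + 3" by simp
    ultimately show ?thesis by (simp only:)
  qed
  then have "\<exists>f. \<forall>i. (f (Suc i), f i) \<in> descent"
    by (intro exI[of _ "\<lambda>i. (i + 2, m i)"]) simp
  then show False using wf_descent wf_iff_no_infinite_down_chain by blast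
qed

end
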